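(* Let $k\geq 2$, let $n,m$ be positive integers, and let $w\in[k]^n$ be a word. For $0\le \ell\le n$ let $M(w\mid \ell)=\max_{v\in[k]^\ell} M(v,w)$. Then \[ M_k(mn)\leq \binom{m+n}{n}\left(\sum_{\ell=0}^n M(w\mid \ell)\right)^{m}. \]
   Context: Words are finite sequences over the alphabet $[k]=\{1,\dots,k\}$. For words $v\in[k]^a$ and $w\in[k]^b$, a map from $v$ to $w$ is a strictly increasing function $f\colon[a]\to[b]$ with $v[i]=w[f(i)]$ for all $i$; $M(v,w)$ denotes the number of such maps (for $v$ the empty word, $M(v,w)=1$). Let $M(w)=\max_v M(v,w)$ over all words $v$ over $[k]$, and $M_k(N)=\min_{w\in[k]^N} M(w)$. *)

theory Defs
  imports Complex_Main "HOL-Library.FuncSet"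
begin

text \<open>
  Words over the alphabet \<open>{1..k}\<close> are lists of natural numbers.  List positions are
  counted from 0, so the positions of a word \<open>v\<close> are \<open>{..<length v}\<close>.
\<close>

definition words :: "nat \<Rightarrow> nat list set" where
  "words k = lists {1..k}"

definition words_len :: "nat \<Rightarrow> nat \<Rightarrow> nat list set" where
  "words_len k n = {w \<in> words k. length w = n}"

text \<open>
  The extensional function space makes maps that agree on the positions of \<open>v\<close> equal, so
  that the cardinality below counts each map exactly once.
\<close>

definition maps :: "nat list \<Rightarrow> nat list \<Rightarrow> (nat \<Rightarrow> nat) set" where
  "maps v w = {f \<in> {..<length v} \<rightarrow>\<^sub>E {..<length w}.
     strict_mono_on {..<length v} f \<and> (\<forall>i<length v. v ! i = w ! f i)}"

definition num_maps :: "nat list \<Rightarrow> nat list \<Rightarrow> nat" where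
  "num_maps v w = card (maps v w)"

definition max_maps :: "nat \<Rightarrow> nat list \<Rightarrow> nat" where
  "max_maps k w = Max ((\<lambda>v. num_maps v w) ` words k)"

definition max_maps_len :: "nat \<Rightarrow> nat list \<Rightarrow> nat \<Rightarrow> nat" where
  "max_maps_len k w l = Max ((\<lambda>v. num_maps v w) ` words_len k l)"

definition min_max_maps :: "nat \<Rightarrow> nat \<Rightarrow> nat" where
  "min_max_maps k N = Min (max_maps k ` words_len k N)"

text \<open>
  \<^const>\<open>Max\<close> and \<^const>\<open>Min\<close> are only meaningful on finite nonempty sets.  The
  following facts show that this is the case in all of the definitions above.
\<close>

lemma finite_maps: "finite (maps v w)"
  unfolding maps_def by (rule finite_subset[OF _ finite_PiE[of "{..<length v}" "\<lambda>_. {..<length w}"]]) auto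

lemma num_maps_Nil: "num_maps [] w = 1"
  by (simp add: num_maps_def maps_def strict_mono_on_def)

lemma num_maps_eq_0:
  assumes "length v > length w"
  shows "num_maps v w = 0"
proof -
  have "maps v w = {}"
  proof (rule equals0I)
    fix f assume "f \<in> maps v w"
    then have "inj_on f {..<length v}" and "f ` {..<length v} \<subseteq> {..<length w}"
      by (auto simp: maps_def strict_mono_on_imp_inj_on)
    then have "card {..<length v} \<le> card {..<length w}"
      by (rule card_inj_on_le) simp
    then show False using assms by simp
  qed
  then show ?thesis by (simp add: num_maps_def)
qed

lemma finite_words_len: "finite (words_len k n)"
proof -
  have "words_len k n = {xs. set xs \<subseteq> {1..k} \<and> length xs = n}"
    by (auto simp: words_len_def words_def)
  then show ?thesis by (simp add: finite_lists_length_eq)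
qed

lemma words_len_nonempty:
  assumes "k \<ge> 1"
  shows "words_len k n \<noteq> {}"
proof -
  have "replicate n 1 \<in> words_len k n"
    using assms by (auto simp: words_len_def words_def)
  then show ?thesis by blast
qed

lemma words_nonempty: "words k \<noteq> {}"
  unfolding words_def by blast

lemma finite_num_maps_words: "finite ((\<lambda>v. num_maps v w) ` words k)"
proof (rule finite_subset)
  show "(\<lambda>v. num_maps v w) ` words k \<subseteq>
      insert 0 ((\<lambda>v. num_maps v w) ` (\<Union>l\<le>length w. words_len k l))"
  proof (rule image_subsetI)
    fix v assume v: "v \<in> words k"
    show "num_maps v w \<in> insert 0 ((\<lambda>v. num_maps v w) ` (\<Union>l\<le>length w. words_len k l))"
    proof (cases "length v \<le> length w")
      case True
      then show ?thesis using v by (auto simp: words_len_def)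
    next
      case False
      then show ?thesis by (simp add: num_maps_eq_0)
    qed
  qed
qed (simp add: finite_words_len)

end

theory Submission
  imports Defs
begin

text \<open>
  The \<open>m\<close>-fold repetition of \<open>w\<close> is a witness for the upper bound.  A map into a concatenation
  \<open>u @ w\<close> splits the source word into a prefix mapped to \<open>u\<close> and a suffix mapped to \<open>w\<close>, and the
  split is determined by the length of the suffix.  So each further copy of \<open>w\<close> multiplies the
  maximal number of maps by at most \<open>\<Sum>\<^sub>\<ell> M(w | \<ell>)\<close>.  This already gives the bound without the
  binomial coefficient.
\<close>

lemma maps_append_subset:
  "maps v (u @ w) \<subseteq> (\<Union>i\<le>length v.
     (\<lambda>(g, h). \<lambda>j\<in>{..<length v}. if j < i then g j else length u + h (j - i)) `
       (maps (take i v) u \<times> maps (drop i v) w))"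
proof
  fix f assume f: "f \<in> maps v (u @ w)"
  have dom: "f j < length u + length w" and letter: "v ! j = (u @ w) ! f j"
    if "j < length v" for j
    using f that by (auto simp: maps_def PiE_def Pi_def)
  have mono: "f a < f b" if "a < b" "b < length v" for a b
    using f that by (auto simp: maps_def strict_mono_on_def)
  have f_ext: "f \<in> extensional {..<length v}"
    using f by (auto simp: maps_def PiE_def)
  \<comment> \<open>The cut is the first position sent past \<open>u\<close>. The disjunct
    \<open>i = length v\<close> keeps the \<open>LEAST\<close> well defined when all of
    \<open>v\<close> lands in \<open>u\<close>; monotonicity of \<open>f\<close> then pushes every
    position from \<open>i\<close> onwards into \<open>w\<close>.\<close>
  define i where "i = (LEAST i. i = length v \<or> length u \<le> f i)"
  have i: "i = length v \<or> length u \<le> f i"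
    unfolding i_def by (rule LeastI[of _ "length v"]) simp
  have i_le: "i \<le> length v"
    unfolding i_def by (rule Least_le) simp
  have low: "f j < length u" if "j < i" for j
    using not_less_Least[OF that[unfolded i_def]] by auto
  have high: "length u \<le> f j" if "i \<le> j" "j < length v" for j
    using i mono[of i j] that by (cases "i = j") auto
  define g where "g = restrict f {..<i}"
  \<comment> \<open>Restricting to exactly the positions of \<open>drop i v\<close> gives the
    extensionality that \<open>maps\<close> demands. The truncated subtraction loses nothing, by
    \<open>high\<close>.\<close>
  define h where "h = (\<lambda>j\<in>{..<length v - i}. f (i + j) - length u)"
  have g: "g \<in> maps (take i v) u"
    using i_le low letter mono
    by (auto simp: maps_def g_def strict_mono_on_def nth_append)
  have h: "h \<in> maps (drop i v) w"
  proof -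
    have "f (i + j) - length u < length w" if "j < length v - i" for j
      using dom[of "i + j"] high[of "i + j"] that by linarith
    moreover have "f (i + a) - length u < f (i + b) - length u"
      if "a < b" "b < length v - i" for a b
      using mono[of "i + a" "i + b"] high[of "i + a"] that by linarith
    moreover have "v ! (i + j) = w ! (f (i + j) - length u)" if "j < length v - i" for j
    proof -
      have "i + j < length v" using that by linarith
      then show ?thesis
        using letter[of "i + j"] high[of "i + j"] by (auto simp: nth_append)
    qed
    ultimately show ?thesis
      using i_le by (auto simp: maps_def h_def strict_mono_on_def)
  qed
  \<comment> \<open>Outside the positions of \<open>v\<close> both sides are
    \<open>undefined\<close>, so they agree as functions and not merely on \<open>v\<close>.\<close>
  have "f = (\<lambda>j\<in>{..<length v}. if j < i then g j else length u + h (j - i))"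
    using f_ext high by (intro ext) (auto simp: g_def h_def extensional_def)
  then show "f \<in> (\<Union>i\<le>length v.
     (\<lambda>(g, h). \<lambda>j\<in>{..<length v}. if j < i then g j else length u + h (j - i)) `
       (maps (take i v) u \<times> maps (drop i v) w))"
    using g h i_le by force
qed

text \<open>A union bound over the cut \<open>i\<close>: for a fixed cut, the glued map is a
  function of the pair \<open>(g, h)\<close>.\<close>

lemma num_maps_append_le:
  "num_maps v (u @ w) \<le> (\<Sum>i\<le>length v. num_maps (take i v) u * num_maps (drop i v) w)"
proof -
  let ?glue = "\<lambda>i. \<lambda>(g, h). \<lambda>j\<in>{..<length v}. if j < i then g j else length u + h (j - i)"
  let ?P = "\<lambda>i. maps (take i v) u \<times> maps (drop i v) w"
  have "num_maps v (u @ w) \<le> card (\<Union>i\<le>length v. ?glue i ` ?P i)"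
    unfolding num_maps_def by (intro card_mono maps_append_subset) (simp add: finite_maps)
  also have "\<dots> \<le> (\<Sum>i\<le>length v. card (?glue i ` ?P i))"
    by (rule card_UN_le) simp
  also have "\<dots> \<le> (\<Sum>i\<le>length v. card (?P i))"
    by (intro sum_mono card_image_le) (simp add: finite_maps)
  finally show ?thesis
    by (simp add: num_maps_def card_cartesian_product)
qed

lemma num_maps_le_max_maps:
  assumes "v \<in> words k"
  shows "num_maps v w \<le> max_maps k w"
  unfolding max_maps_def using assms by (intro Max_ge finite_num_maps_words imageI)

lemma num_maps_le_max_maps_len:
  assumes "v \<in> words k"
  shows "num_maps v w \<le> max_maps_len k w (length v)"
  unfolding max_maps_len_def using assms
  by (intro Max_ge finite_imageI finite_words_len) (auto simp: words_len_def)

lemma max_maps_leI: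
  assumes "\<And>v. v \<in> words k \<Longrightarrow> num_maps v w \<le> C"
  shows "max_maps k w \<le> C"
  unfolding max_maps_def using assms
  by (subst Max_le_iff) (auto simp: finite_num_maps_words words_nonempty)

text \<open>Different cuts leave suffixes of different lengths, so each length is charged at most
  once, and suffixes longer than \<open>w\<close> contribute 0.\<close>

lemma sum_num_maps_drop_le:
  assumes "v \<in> words k"
  shows "(\<Sum>i\<le>length v. num_maps (drop i v) w) \<le> (\<Sum>l=0..length w. max_maps_len k w l)"
proof -
  let ?I = "{i. i \<le> length v \<and> length v - i \<le> length w}"
  have "(\<Sum>i\<le>length v. num_maps (drop i v) w) = (\<Sum>i\<in>?I. num_maps (drop i v) w)"
    by (rule sum.mono_neutral_right) (auto intro!: num_maps_eq_0)
  also have "\<dots> \<le> (\<Sum>i\<in>?I. max_maps_len k w (length v - i))"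
  proof (rule sum_mono)
    fix i
    have "drop i v \<in> words k"
      using assms by (auto simp: words_def dest: in_set_dropD)
    from num_maps_le_max_maps_len[OF this, of w]
    show "num_maps (drop i v) w \<le> max_maps_len k w (length v - i)" by simp
  qed
  \<comment> \<open>On \<open>?I\<close> the subtraction is genuine because
    \<open>i \<le> length v\<close>, hence the suffix length determines the cut.\<close>
  also have "\<dots> = (\<Sum>l\<in>(\<lambda>i. length v - i) ` ?I. max_maps_len k w l)"
    by (subst sum.reindex) (auto simp: inj_on_def)
  also have "\<dots> \<le> (\<Sum>l=0..length w. max_maps_len k w l)"
    by (rule sum_mono2) auto
  finally show ?thesis .
qed

text \<open>Bounding the prefix factor by \<open>max_maps k u\<close> uniformly in the cut leaves a
  sum over suffixes alone.\<close>

lemma max_maps_append_le: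
  "max_maps k (u @ w) \<le> max_maps k u * (\<Sum>l=0..length w. max_maps_len k w l)"
proof (rule max_maps_leI)
  fix v assume v: "v \<in> words k"
  have "num_maps (take i v) u \<le> max_maps k u" for i
    using v by (intro num_maps_le_max_maps) (auto simp: words_def dest: in_set_takeD)
  then have "num_maps v (u @ w) \<le> (\<Sum>i\<le>length v. max_maps k u * num_maps (drop i v) w)"
    by (intro order_trans[OF num_maps_append_le] sum_mono mult_right_mono) auto
  also have "\<dots> = max_maps k u * (\<Sum>i\<le>length v. num_maps (drop i v) w)"
    by (simp add: sum_distrib_left)
  also have "\<dots> \<le> max_maps k u * (\<Sum>l=0..length w. max_maps_len k w l)"
    using v by (intro mult_left_mono sum_num_maps_drop_le) auto
  finally show "num_maps v (u @ w) \<le> max_maps k u * (\<Sum>l=0..length w. max_maps_len k w l)" .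
qed

lemma max_maps_Nil_le: "max_maps k [] \<le> 1"
proof (rule max_maps_leI)
  fix v show "num_maps v [] \<le> 1"
    by (cases v) (simp_all add: num_maps_Nil num_maps_eq_0)
qed

text \<open>Each iteration appends \<open>w\<close> on the right, so the induction step is one use
  of \<open>max_maps_append_le\<close>.\<close>

lemma max_maps_repeat_le:
  "max_maps k (((\<lambda>u. u @ w) ^^ m) []) \<le> (\<Sum>l=0..length w. max_maps_len k w l) ^ m"
proof (induction m)
  case 0
  show ?case using max_maps_Nil_le by simp
next
  case (Suc m)
  let ?S = "\<Sum>l=0..length w. max_maps_len k w l"
  have "max_maps k (((\<lambda>u. u @ w) ^^ Suc m) []) \<le> max_maps k (((\<lambda>u. u @ w) ^^ m) []) * ?S"
    using max_maps_append_le by simp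
  also have "\<dots> \<le> ?S ^ m * ?S"
    by (rule mult_right_mono[OF Suc.IH]) simp
  finally show ?case by (simp add: mult.commute)
qed

lemma repeat_in_words_len:
  assumes "w \<in> words_len k n"
  shows "((\<lambda>u. u @ w) ^^ m) [] \<in> words_len k (m * n)"
  using assms by (induction m) (auto simp: words_len_def words_def)

theorem theorem4:
  fixes k n m :: nat and w :: "nat list"
  assumes "k \<ge> 2" and "n \<ge> 1" and "m \<ge> 1"
    and "w \<in> words_len k n"
  shows "min_max_maps k (m * n) \<le> ((m + n) choose n) * (\<Sum>l=0..n. max_maps_len k w l) ^ m"
proof -
  let ?S = "\<Sum>l=0..n. max_maps_len k w l"
  have "min_max_maps k (m * n) \<le> max_maps k (((\<lambda>u. u @ w) ^^ m) [])"
    unfolding min_max_maps_def using assms(4)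
    by (intro Min_le finite_imageI imageI finite_words_len repeat_in_words_len)
  also have "\<dots> \<le> ?S ^ m"
    using max_maps_repeat_le[where k = k and w = w and m = m] assms(4) by (simp add: words_len_def)
  \<comment> \<open>The binomial coefficient is at least 1, since
    \<open>n \<le> m + n\<close>.\<close>
  also have "\<dots> \<le> ((m + n) choose n) * ?S ^ m"
    by (simp add: Suc_le_eq)
  finally show ?thesis .
qed

end
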